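(* Let $\tau\ge2$ be a cardinal number. The following conditions are equivalent for any Polish group $G$: (i) $G$ is topologically isomorphic to a closed subgroup of $S_\infty$; (ii) $G$ is topologically isomorphic to a closed subgroup of $S_\infty^\tau$.
   Context: $S_\infty$ is the symmetric group, i.e. the group of all bijections of $\mathbb N$ with the relative topology inherited from $\mathbb N^{\mathbb N}$ (product topology, $\mathbb N$ discrete); $S_\infty^\tau$ is its $\tau$-th power with the product topology. Topologically isomorphic means isomorphic as topological groups. *)

theory Defs
  imports
    "HOL-Analysis.Analysis"
    "HOL-Algebra.Bij"
    "HOL-Algebra.Product_Groups"
begin

unbundle cardinal_syntax

definition topological_group :: "('a, 'm) monoid_scheme \<Rightarrow> 'a topology \<Rightarrow> bool" where
  "topological_group G T \<longleftrightarrow>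
     group G \<and> topspace T = carrier G \<and>
     continuous_map (prod_topology T T) T (\<lambda>(x, y). x \<otimes>\<^bsub>G\<^esub> y) \<and>
     continuous_map T T (\<lambda>x. inv\<^bsub>G\<^esub> x)"

definition polish_group :: "('a, 'm) monoid_scheme \<Rightarrow> 'a topology \<Rightarrow> bool" where
  "polish_group G T \<longleftrightarrow>
     topological_group G T \<and> completely_metrizable_space T \<and> separable_space T"

definition topologically_isomorphic ::
  "('a, 'm) monoid_scheme \<Rightarrow> 'a topology \<Rightarrow> ('b, 'n) monoid_scheme \<Rightarrow> 'b topology \<Rightarrow> bool" where
  "topologically_isomorphic G T K S \<longleftrightarrow> (\<exists>f. f \<in> iso G K \<and> homeomorphic_map T S f)"

definition isomorphic_to_closed_subgroup ::
  "('a, 'm) monoid_scheme \<Rightarrow> 'a topology \<Rightarrow> ('b, 'n) monoid_scheme \<Rightarrow> 'b topology \<Rightarrow> bool" where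
  "isomorphic_to_closed_subgroup G T K S \<longleftrightarrow>
     (\<exists>H. subgroup H K \<and> closedin S H \<and>
          topologically_isomorphic G T (K\<lparr>carrier := H\<rparr>) (subtopology S H))"

definition S_inf :: "(nat \<Rightarrow> nat) monoid" where
  "S_inf = BijGroup UNIV"

definition S_inf_top :: "(nat \<Rightarrow> nat) topology" where
  "S_inf_top =
     subtopology (product_topology (\<lambda>_. discrete_topology UNIV) UNIV) (carrier S_inf)"

text \<open>A cardinal is a relation satisfying \<^const>\<open>Card_order\<close>; its underlying set, of that
  cardinality, is its \<^const>\<open>Field\<close>, which serves as the index set of the power.\<close>

definition S_inf_power :: "'i rel \<Rightarrow> ('i \<Rightarrow> nat \<Rightarrow> nat) monoid" where
  "S_inf_power \<tau> = product_group (Field \<tau>) (\<lambda>_. S_inf)"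

definition S_inf_power_top :: "'i rel \<Rightarrow> ('i \<Rightarrow> nat \<Rightarrow> nat) topology" where
  "S_inf_power_top \<tau> = product_topology (\<lambda>_. S_inf_top) (Field \<tau>)"

end

theory Submission
  imports Defs
begin

text \<open>
  A nonempty power of \<^const>\<open>S_inf\<close> contains \<^const>\<open>S_inf\<close> as one of its coordinate
  subgroups, and this subgroup is closed; so a closed subgroup of \<^const>\<open>S_inf\<close> is a closed
  subgroup of the power (\<open>S_inf_isomorphic_to_closed_subgroup_power\<close>).

  For the converse let \<open>f\<close> embed \<open>G\<close> as a closed subgroup of a power with a possibly
  uncountable exponent. A basic neighbourhood of the identity of the power constrains finitely many
  coordinates. As \<open>G\<close> is metrizable, countably many such neighbourhoods suffice to describe
  the topology of \<open>G\<close> at \<open>\<one>\<close>, hence so do countably many coordinates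
  (\<open>countably_many_coordinates\<close>). Enumerate them as \<open>j 0, j 1, \<dots>\<close>. The permutations
  \<open>f x (j a)\<close> act on countably many disjoint copies of the natural numbers, which a pairing
  function merges into one copy; this gives a homomorphism from \<open>G\<close> to \<^const>\<open>S_inf\<close>
  that is a topological embedding (\<open>interleave\<close>, \<open>embedding_map_S_inf\<close>).

  The delicate point is that its image is closed, since dropping coordinates does not preserve
  closedness of sets. What survives is an intrinsic property of \<open>G\<close>: every two-sided Cauchy
  sequence of \<open>G\<close> converges. Indeed, \<open>f\<close> sends such a sequence to one that is
  two-sided Cauchy in every coordinate; a sequence of permutations whose values and whose inverses'
  values all stabilise has a permutation as its limit; and the image of \<open>f\<close> is closed
  (\<open>closed_in_S_inf_power_imp_complete\<close>). Conversely, a point in the closure of an embedded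
  copy of \<open>G\<close> in \<^const>\<open>S_inf\<close> is the limit of a two-sided Cauchy sequence of
  \<open>G\<close>, so completeness puts it into the image (\<open>closedin_image_S_inf\<close>).
\<close>

section \<open>The group of permutations of the natural numbers\<close>

lemma carrier_S_inf [simp]: "carrier S_inf = {f. bij f}"
  by (auto simp: S_inf_def BijGroup_def Bij_def)

lemma one_S_inf [simp]: "\<one>\<^bsub>S_inf\<^esub> = id"
  by (auto simp: S_inf_def BijGroup_def)

lemma mult_S_inf: "bij f \<Longrightarrow> bij g \<Longrightarrow> f \<otimes>\<^bsub>S_inf\<^esub> g = f \<circ> g"
  by (auto simp: S_inf_def BijGroup_def Bij_def compose_def)

lemma group_S_inf: "group S_inf"
  unfolding S_inf_def by (rule group_BijGroup)

lemma inv_S_inf: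
  assumes "bij f"
  shows "inv\<^bsub>S_inf\<^esub> f = inv_into UNIV f"
proof (rule group.inv_equality [OF group_S_inf])
  show "inv_into UNIV f \<otimes>\<^bsub>S_inf\<^esub> f = \<one>\<^bsub>S_inf\<^esub>"
    using assms by (simp add: mult_S_inf bij_imp_bij_inv bij_is_inj)
qed (use assms in \<open>auto simp: bij_imp_bij_inv\<close>)

lemma hom_S_inf:
  assumes "group G" "\<phi> \<in> hom G S_inf"
  shows hom_S_inf_bij: "x \<in> carrier G \<Longrightarrow> bij (\<phi> x)"
    and hom_S_inf_mult: "x \<in> carrier G \<Longrightarrow> y \<in> carrier G \<Longrightarrow> \<phi> (x \<otimes>\<^bsub>G\<^esub> y) = \<phi> x \<circ> \<phi> y"
    and hom_S_inf_inv: "x \<in> carrier G \<Longrightarrow> \<phi> (inv\<^bsub>G\<^esub> x) = inv_into UNIV (\<phi> x)"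
    and hom_S_inf_one: "\<phi> \<one>\<^bsub>G\<^esub> = id"
proof -
  interpret group_hom G S_inf \<phi>
    using assms by (simp add: group_hom_def group_hom_axioms_def group_S_inf)
  show *: "bij (\<phi> x)" if "x \<in> carrier G" for x
    using hom_closed [OF that] by simp
  show "x \<in> carrier G \<Longrightarrow> y \<in> carrier G \<Longrightarrow> \<phi> (x \<otimes>\<^bsub>G\<^esub> y) = \<phi> x \<circ> \<phi> y"
    by (simp add: mult_S_inf *)
  show "x \<in> carrier G \<Longrightarrow> \<phi> (inv\<^bsub>G\<^esub> x) = inv_into UNIV (\<phi> x)"
    by (simp add: inv_S_inf *)
  show "\<phi> \<one>\<^bsub>G\<^esub> = id"
    by simp
qed

lemma topspace_S_inf_top [simp]: "topspace S_inf_top = {f. bij f}"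
  by (simp add: S_inf_top_def)

lemma openin_S_inf_top_value: "openin S_inf_top {f. bij f \<and> f k = m}"
proof -
  have "openin (product_topology (\<lambda>_::nat. discrete_topology (UNIV::nat set)) UNIV)
      {f \<in> topspace (product_topology (\<lambda>_::nat. discrete_topology (UNIV::nat set)) UNIV). f k \<in> {m}}"
    by (rule openin_continuous_map_preimage [OF continuous_map_product_coordinates]) auto
  then show ?thesis
    unfolding S_inf_top_def openin_subtopology
    by (intro exI [of _ "{f. f k = m}"]) auto
qed

lemma S_inf_top_neighbourhood:
  assumes "openin S_inf_top U" "x \<in> U"
  obtains n where "\<And>y. bij y \<Longrightarrow> (\<And>k. k < n \<Longrightarrow> y k = x k) \<Longrightarrow> y \<in> U"
proof -
  obtain W where W: "openin (product_topology (\<lambda>_::nat. discrete_topology (UNIV::nat set)) UNIV) W"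
    and U: "U = W \<inter> {f. bij f}"
    using assms by (auto simp: S_inf_top_def openin_subtopology)
  obtain V where fin: "finite {i::nat. V i \<noteq> (UNIV::nat set)}"
    and x: "x \<in> PiE UNIV V" and V: "PiE UNIV V \<subseteq> W"
    using W assms unfolding U openin_product_topology_alt by force
  obtain n where n: "\<And>i. V i \<noteq> UNIV \<Longrightarrow> i < n"
    using fin by (auto simp: finite_nat_set_iff_bounded)
  show thesis
  proof
    fix y :: "nat \<Rightarrow> nat"
    assume y: "bij y" "\<And>k. k < n \<Longrightarrow> y k = x k"
    have "y k \<in> V k" for k
    proof (cases "V k = UNIV")
      case False
      then show ?thesis
        using n [OF False] y(2) PiE_mem [OF x] by simp
    qed simp
    then have "y \<in> PiE UNIV V"
      by (simp add: PiE_iff)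
    then show "y \<in> U"
      using V y(1) unfolding U by blast
  qed
qed

lemma Hausdorff_space_S_inf_top: "Hausdorff_space S_inf_top"
  unfolding S_inf_top_def
  by (intro Hausdorff_space_subtopology) (simp add: Hausdorff_space_product_topology)

lemma limitin_S_inf_top:
  "limitin S_inf_top f l F \<longleftrightarrow>
     bij l \<and> (\<forall>\<^sub>F a in F. bij (f a)) \<and> (\<forall>k. \<forall>\<^sub>F a in F. f a k = l k)"
proof -
  have "limitin (discrete_topology UNIV) g m F \<longleftrightarrow> (\<forall>\<^sub>F a in F. g a = m)" for g and m :: nat
  proof
    assume "limitin (discrete_topology UNIV) g m F"
    from limitinD [OF this, of "{m}"] show "\<forall>\<^sub>F a in F. g a = m"
      by simp
  next
    assume "\<forall>\<^sub>F a in F. g a = m"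
    then show "limitin (discrete_topology UNIV) g m F"
      by (intro limitin_eventually) simp_all
  qed
  then show ?thesis
    by (auto simp: S_inf_top_def limitin_subtopology limitin_componentwise)
qed

text \<open>
  Stability of the values alone would only make the limit injective: pointwise limits of
  permutations need not be surjective. Stability of the inverses supplies a two-sided inverse of
  the limit.
\<close>

lemma S_inf_pointwise_limit:
  fixes x :: "nat \<Rightarrow> nat \<Rightarrow> nat"
  assumes bij: "\<And>n. bij (x n)"
    and val: "\<And>k. \<exists>N. \<forall>m\<ge>N. \<forall>n\<ge>N. x m k = x n k"
    and inv_val: "\<And>k. \<exists>N. \<forall>m\<ge>N. \<forall>n\<ge>N. inv_into UNIV (x m) k = inv_into UNIV (x n) k"
  shows "\<exists>l. limitin S_inf_top x l sequentially"
proof -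
  obtain N where N: "\<And>k m n. m \<ge> N k \<Longrightarrow> n \<ge> N k \<Longrightarrow> x m k = x n k"
    using val by metis
  obtain M where M: "\<And>k m n. m \<ge> M k \<Longrightarrow> n \<ge> M k \<Longrightarrow> inv_into UNIV (x m) k = inv_into UNIV (x n) k"
    using inv_val by metis
  define l where "l k = x (N k) k" for k
  define l' where "l' k = inv_into UNIV (x (M k)) k" for k
  have l: "x n k = l k" if "n \<ge> N k" for n k
    using N [of k n "N k"] that by (simp add: l_def)
  have l': "inv_into UNIV (x n) k = l' k" if "n \<ge> M k" for n k
    using M [of k n "M k"] that by (simp add: l'_def)
  have "l' (l k) = k" for k
  proof -
    \<comment> \<open>a stage so late that both values occurring here are final\<close>
    define n where "n = max (N k) (M (l k))"
    have "l' (l k) = inv_into UNIV (x n) (x n k)"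
      using l [of k n] l' [of "l k" n] by (simp add: n_def)
    also have "\<dots> = k"
      using bij_is_inj [OF bij] by (rule inv_f_f)
    finally show ?thesis .
  qed
  then have inv1: "l' \<circ> l = id"
    by (simp add: fun_eq_iff)
  have "l (l' k) = k" for k
  proof -
    define n where "n = max (M k) (N (l' k))"
    have "l (l' k) = x n (inv_into UNIV (x n) k)"
      using l [of "l' k" n] l' [of k n] by (simp add: n_def)
    also have "\<dots> = k"
      using bij_is_surj [OF bij] by (rule surj_f_inv_f)
    finally show ?thesis .
  qed
  then have inv2: "l \<circ> l' = id"
    by (simp add: fun_eq_iff)
  have "bij l"
    using inv1 inv2 by (rule o_bij)
  moreover have "\<exists>N. \<forall>n\<ge>N. x n k = l k" for k
    using l by blast
  ultimately have "limitin S_inf_top x l sequentially"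
    by (simp add: limitin_S_inf_top bij eventually_sequentially)
  then show ?thesis by blast
qed

section \<open>Powers of the permutation group\<close>

lemma group_S_inf_power: "group (S_inf_power \<tau>)"
  by (simp add: S_inf_power_def group_S_inf)

lemma hom_S_inf_power_coordinate:
  assumes "f \<in> hom G (S_inf_power \<tau>)" "i \<in> Field \<tau>"
  shows "(\<lambda>x. f x i) \<in> hom G S_inf"
  using assms by (auto simp: hom_def S_inf_power_def PiE_iff Pi_iff)

lemma continuous_map_S_inf_power_coordinate:
  assumes "continuous_map T (S_inf_power_top \<tau>) f" "i \<in> Field \<tau>"
  shows "continuous_map T S_inf_top (\<lambda>x. f x i)"
  using assms by (simp add: S_inf_power_top_def continuous_map_componentwise)

lemma S_inf_power_top_neighbourhood_one:
  assumes "openin (S_inf_power_top \<tau>) U" "\<one>\<^bsub>S_inf_power \<tau>\<^esub> \<in> U"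
  shows "\<exists>F n. finite F \<and> F \<subseteq> Field \<tau> \<and>
           (\<forall>h \<in> carrier (S_inf_power \<tau>). (\<forall>i\<in>F. \<forall>k<n. h i k = k) \<longrightarrow> h \<in> U)"
proof -
  obtain V where fin: "finite {i \<in> Field \<tau>. V i \<noteq> topspace S_inf_top}"
    and op: "\<And>i. i \<in> Field \<tau> \<Longrightarrow> openin S_inf_top (V i)"
    and one: "\<one>\<^bsub>S_inf_power \<tau>\<^esub> \<in> PiE (Field \<tau>) V" and V: "PiE (Field \<tau>) V \<subseteq> U"
    using assms unfolding S_inf_power_top_def openin_product_topology_alt by meson
  define F where "F = {i \<in> Field \<tau>. V i \<noteq> topspace S_inf_top}"
  have "\<exists>n. \<forall>y. bij y \<longrightarrow> (\<forall>k<n. y k = k) \<longrightarrow> y \<in> V i" if "i \<in> Field \<tau>" for i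
  proof -
    have "id \<in> V i"
      using one that by (auto simp: S_inf_power_def PiE_iff)
    from S_inf_top_neighbourhood [OF op [OF that] this] show ?thesis
      by (metis id_apply)
  qed
  then obtain n where n: "\<And>i y. i \<in> Field \<tau> \<Longrightarrow> bij y \<Longrightarrow> (\<forall>k<n i. y k = k) \<Longrightarrow> y \<in> V i"
    by metis
  obtain N where N: "\<And>i. i \<in> F \<Longrightarrow> n i \<le> N"
    using finite_nat_set_iff_bounded_le [of "n ` F"] fin by (auto simp: F_def)
  have "h \<in> U" if h: "h \<in> carrier (S_inf_power \<tau>)" "\<forall>i\<in>F. \<forall>k<N. h i k = k" for h
  proof -
    have "h i \<in> V i" if "i \<in> Field \<tau>" for i
    proof (cases "i \<in> F")
      case True
      then show ?thesis
        using n [OF that, of "h i"] N [OF True] h that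
        by (auto simp: S_inf_power_def PiE_iff)
    next
      case False
      then show ?thesis
        using h that by (auto simp: F_def S_inf_power_def PiE_iff)
    qed
    then have "h \<in> PiE (Field \<tau>) V"
      using h by (simp add: S_inf_power_def PiE_iff)
    then show ?thesis
      using V by blast
  qed
  then show ?thesis
    using fin by (intro exI [of _ F] exI [of _ N]) (auto simp: F_def)
qed

section \<open>Closed embeddings of topological groups\<close>

lemma embedding_imp_continuous_map: "embedding_map X Y f \<Longrightarrow> continuous_map X Y f"
  unfolding embedding_map_def
  by (drule homeomorphic_imp_continuous_map) (simp add: continuous_map_in_subtopology)

text \<open>
  Speaking of the embedding instead of its image makes closed subgroups easy to compose.
\<close>

lemma isomorphic_to_closed_subgroup_iff_embedding:
  assumes "group G" "group K" "topspace T = carrier G"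
  shows "isomorphic_to_closed_subgroup G T K S \<longleftrightarrow>
           (\<exists>f \<in> hom G K. embedding_map T S f \<and> closedin S (f ` carrier G))"
proof
  assume "isomorphic_to_closed_subgroup G T K S"
  then obtain H f where H: "subgroup H K" "closedin S H"
    and f: "f \<in> iso G (K\<lparr>carrier := H\<rparr>)" "homeomorphic_map T (subtopology S H) f"
    by (auto simp: isomorphic_to_closed_subgroup_def topologically_isomorphic_def)
  have im: "f ` carrier G = H"
    using f by (auto simp: iso_def bij_betw_def)
  have "f \<in> hom G K"
    using f subgroup.subset [OF H(1)] by (auto simp: iso_def hom_def)
  then show "\<exists>f \<in> hom G K. embedding_map T S f \<and> closedin S (f ` carrier G)"
    using f H im assms by (auto simp: embedding_map_def)
next
  assume "\<exists>f \<in> hom G K. embedding_map T S f \<and> closedin S (f ` carrier G)"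
  then obtain f where f: "f \<in> hom G K" "embedding_map T S f" "closedin S (f ` carrier G)"
    by blast
  interpret group_hom G K f
    using assms f by (simp add: group_hom_def group_hom_axioms_def)
  have homeo: "homeomorphic_map T (subtopology S (f ` carrier G)) f"
    using f assms by (simp add: embedding_map_def)
  then have "f \<in> iso G (K\<lparr>carrier := f ` carrier G\<rparr>)"
    using f assms homeomorphic_imp_injective_map [OF homeo]
    by (auto simp: iso_def hom_def bij_betw_def)
  then show "isomorphic_to_closed_subgroup G T K S"
    using f homeo img_is_subgroup
    by (auto simp: isomorphic_to_closed_subgroup_def topologically_isomorphic_def)
qed

lemma isomorphic_to_closed_subgroup_trans:
  assumes "group G" "group K" "group L" "topspace T = carrier G" "topspace S = carrier K"
    and "isomorphic_to_closed_subgroup G T K S" "isomorphic_to_closed_subgroup K S L R"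
  shows "isomorphic_to_closed_subgroup G T L R"
proof -
  obtain f where f: "f \<in> hom G K" "embedding_map T S f" "closedin S (f ` carrier G)"
    using assms by (auto simp: isomorphic_to_closed_subgroup_iff_embedding)
  obtain e where e: "e \<in> hom K L" "embedding_map S R e" "closedin R (e ` carrier K)"
    using assms by (auto simp: isomorphic_to_closed_subgroup_iff_embedding)
  have "closed_map S R e"
    using e assms by (simp add: embedding_imp_closed_map)
  then have "closedin R ((e \<circ> f) ` carrier G)"
    using f unfolding closed_map_def image_comp [symmetric] by blast
  moreover have "e \<circ> f \<in> hom G L" "embedding_map T R (e \<circ> f)"
    using f e by (auto intro: hom_compose embedding_map_compose)
  ultimately show ?thesis
    using assms by (auto simp: isomorphic_to_closed_subgroup_iff_embedding)
qed

text \<open>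
  The embedding into the coordinate \<open>i\<close> has the projection as a continuous left inverse, and
  its image is a product of closed sets: the whole group in coordinate \<open>i\<close>, a single point
  elsewhere.
\<close>

lemma S_inf_isomorphic_to_closed_subgroup_power:
  assumes "i \<in> Field \<tau>"
  shows "isomorphic_to_closed_subgroup S_inf S_inf_top (S_inf_power \<tau>) (S_inf_power_top \<tau>)"
proof -
  define e where "e = (\<lambda>x. \<lambda>j\<in>Field \<tau>. if j = i then x else (id :: nat \<Rightarrow> nat))"
  have "e \<in> hom S_inf (S_inf_power \<tau>)"
    by (auto simp: e_def hom_def S_inf_power_def mult_S_inf intro!: restrict_ext bij_comp)
  moreover have "embedding_map S_inf_top (S_inf_power_top \<tau>) e"
  proof -
    have "continuous_map S_inf_top S_inf_top (\<lambda>x. if j = i then x else id)" for j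
      by (cases "j = i") auto
    then have "continuous_map S_inf_top (S_inf_power_top \<tau>) e"
      by (auto simp: S_inf_power_top_def continuous_map_componentwise e_def cong: if_cong)
    moreover have "continuous_map (S_inf_power_top \<tau>) S_inf_top (\<lambda>h. h i)"
      unfolding S_inf_power_top_def by (rule continuous_map_product_coordinates [OF assms])
    ultimately have "section_map S_inf_top (S_inf_power_top \<tau>) e"
      using assms unfolding section_map_def retraction_maps_def
      by (intro exI [of _ "\<lambda>h. h i"]) (auto simp: e_def)
    then show ?thesis
      by (rule section_imp_embedding_map)
  qed
  moreover have "closedin (S_inf_power_top \<tau>) (e ` carrier S_inf)"
  proof -
    define C where "C = (\<lambda>j. if j = i then {f :: nat \<Rightarrow> nat. bij f} else {id})"
    have "e ` carrier S_inf = PiE (Field \<tau>) C"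
    proof (intro equalityI subsetI)
      fix h assume h: "h \<in> PiE (Field \<tau>) C"
      then have "h = e (h i)"
        by (intro ext) (auto simp: e_def C_def PiE_iff extensional_def split: if_splits)
      moreover have "bij (h i)"
        using h assms by (auto simp: C_def PiE_iff split: if_splits)
      ultimately show "h \<in> e ` carrier S_inf"
        by auto
    qed (auto simp: e_def C_def)
    moreover have "closedin S_inf_top (C j)" for j
      using closedin_topspace [of S_inf_top]
        closedin_Hausdorff_singleton [OF Hausdorff_space_S_inf_top, of id]
      by (simp add: C_def)
    ultimately show ?thesis
      by (simp add: S_inf_power_top_def closedin_product_topology)
  qed
  moreover have "topspace S_inf_top = carrier S_inf"
    by simp
  ultimately show ?thesis
    unfolding isomorphic_to_closed_subgroup_iff_embedding [OF group_S_inf group_S_inf_power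
        \<open>topspace S_inf_top = carrier S_inf\<close>]
    by blast
qed

section \<open>Two-sided Cauchy sequences\<close>

text \<open>
  These are the Cauchy sequences of the two-sided uniformity of \<open>G\<close>. One side
  would not do: in \<^const>\<open>S_inf\<close> the left quotients control only the values and the right
  quotients only the values of the inverses.
\<close>

definition two_sided_Cauchy :: "('a, 'm) monoid_scheme \<Rightarrow> 'a topology \<Rightarrow> (nat \<Rightarrow> 'a) \<Rightarrow> bool" where
  "two_sided_Cauchy G T g \<longleftrightarrow> range g \<subseteq> carrier G \<and>
     (\<forall>U. openin T U \<and> \<one>\<^bsub>G\<^esub> \<in> U \<longrightarrow>
        (\<exists>N. \<forall>m\<ge>N. \<forall>n\<ge>N. inv\<^bsub>G\<^esub> g n \<otimes>\<^bsub>G\<^esub> g m \<in> U \<and> g n \<otimes>\<^bsub>G\<^esub> inv\<^bsub>G\<^esub> g m \<in> U))"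

text \<open>
  Fixing \<open>k\<close> is an open condition on \<open>\<phi> x\<close>. Applied to \<open>(g n)\<inverse> (g m)\<close>
  it makes the values at \<open>k\<close> stabilise, applied to \<open>g n (g m)\<inverse>\<close> the values of
  the inverses.
\<close>

lemma two_sided_Cauchy_image_convergent:
  assumes G: "topological_group G T"
    and \<phi>: "\<phi> \<in> hom G S_inf" "continuous_map T S_inf_top \<phi>"
    and g: "two_sided_Cauchy G T g"
  shows "\<exists>l. limitin S_inf_top (\<lambda>n. \<phi> (g n)) l sequentially"
proof -
  have grp: "group G" and top: "topspace T = carrier G"
    using G by (auto simp: topological_group_def)
  interpret group G by (rule grp)
  note hom = hom_S_inf_bij [OF grp \<phi>(1)] hom_S_inf_mult [OF grp \<phi>(1)]
    hom_S_inf_inv [OF grp \<phi>(1)] hom_S_inf_one [OF grp \<phi>(1)]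
  have gG: "g n \<in> carrier G" for n
    using g by (auto simp: two_sided_Cauchy_def)
  have bij: "bij (\<phi> (g n))" for n
    by (simp add: hom gG)
  have ev: "\<exists>N. \<forall>m\<ge>N. \<forall>n\<ge>N. \<phi> (g m) k = \<phi> (g n) k \<and> inv_into UNIV (\<phi> (g m)) k = inv_into UNIV (\<phi> (g n)) k" for k
  proof -
    define U where "U = {x \<in> topspace T. \<phi> x \<in> {f. bij f \<and> f k = k}}"
    have "openin T U"
      unfolding U_def by (rule openin_continuous_map_preimage [OF \<phi>(2) openin_S_inf_top_value])
    moreover have "\<one>\<^bsub>G\<^esub> \<in> U"
      by (simp add: U_def top hom)
    ultimately obtain N where
      N: "\<And>m n. m \<ge> N \<Longrightarrow> n \<ge> N \<Longrightarrow> inv\<^bsub>G\<^esub> g n \<otimes>\<^bsub>G\<^esub> g m \<in> U \<and> g n \<otimes>\<^bsub>G\<^esub> inv\<^bsub>G\<^esub> g m \<in> U"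
      using g unfolding two_sided_Cauchy_def by meson
    have "\<phi> (g m) k = \<phi> (g n) k \<and> inv_into UNIV (\<phi> (g m)) k = inv_into UNIV (\<phi> (g n)) k"
      if "m \<ge> N" "n \<ge> N" for m n
    proof -
      have "inv_into UNIV (\<phi> (g n)) (\<phi> (g m) k) = k" "\<phi> (g n) (inv_into UNIV (\<phi> (g m)) k) = k"
        using N [OF that] by (auto simp: U_def hom gG)
      then show ?thesis
        using bij_inv_eq_iff [OF bij] by metis
    qed
    then show ?thesis by blast
  qed
  show ?thesis
  proof (rule S_inf_pointwise_limit)
    show "\<exists>N. \<forall>m\<ge>N. \<forall>n\<ge>N. \<phi> (g m) k = \<phi> (g n) k" for k
      using ev [of k] by meson
    show "\<exists>N. \<forall>m\<ge>N. \<forall>n\<ge>N. inv_into UNIV (\<phi> (g m)) k = inv_into UNIV (\<phi> (g n)) k" for k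
      using ev [of k] by meson
  qed (rule bij)
qed

text \<open>
  Limits in the power are taken coordinatewise, so the images converge in the power; the limit lies
  in the closed image of \<open>f\<close> and is pulled back along the embedding.
\<close>

lemma closed_in_S_inf_power_imp_complete:
  assumes G: "topological_group G T"
    and f: "f \<in> hom G (S_inf_power \<tau>)" "embedding_map T (S_inf_power_top \<tau>) f"
      "closedin (S_inf_power_top \<tau>) (f ` carrier G)"
    and g: "two_sided_Cauchy G T g"
  shows "\<exists>l. limitin T g l sequentially"
proof -
  have top: "topspace T = carrier G"
    using G by (auto simp: topological_group_def)
  have gG: "g n \<in> carrier G" for n
    using g by (auto simp: two_sided_Cauchy_def)
  have cont: "continuous_map T (S_inf_power_top \<tau>) f"
    using f(2) by (simp add: embedding_imp_continuous_map)
  have "\<exists>l. limitin S_inf_top (\<lambda>n. f (g n) i) l sequentially" if "i \<in> Field \<tau>" for i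
    using two_sided_Cauchy_image_convergent [OF G hom_S_inf_power_coordinate [OF f(1) that]
        continuous_map_S_inf_power_coordinate [OF cont that] g] .
  then obtain h where h: "\<And>i. i \<in> Field \<tau> \<Longrightarrow> limitin S_inf_top (\<lambda>n. f (g n) i) (h i) sequentially"
    by metis
  have fg: "f (g n) \<in> topspace (S_inf_power_top \<tau>)" for n
    using gG closedin_subset [OF f(3)] by auto
  have lim: "limitin (S_inf_power_top \<tau>) (\<lambda>n. f (g n)) (restrict h (Field \<tau>)) sequentially"
    using h fg by (simp add: S_inf_power_top_def limitin_componentwise)
  have "restrict h (Field \<tau>) \<in> f ` carrier G"
    using limitin_closedin [OF lim f(3)] gG by auto
  with lim have lim': "limitin (subtopology (S_inf_power_top \<tau>) (f ` carrier G))
      (\<lambda>n. f (g n)) (restrict h (Field \<tau>)) sequentially"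
    using gG by (auto simp: limitin_subtopology)
  obtain f' where f': "homeomorphic_maps T (subtopology (S_inf_power_top \<tau>) (f ` carrier G)) f f'"
    using f(2) top by (auto simp: embedding_map_def homeomorphic_map_maps)
  have "limitin T (f' \<circ> (\<lambda>n. f (g n))) (f' (restrict h (Field \<tau>))) sequentially"
    using f' lim' by (intro continuous_map_limit) (auto simp: homeomorphic_maps_def)
  moreover have "f' \<circ> (\<lambda>n. f (g n)) = g"
    using f' gG top by (simp add: homeomorphic_maps_def fun_eq_iff)
  ultimately have "limitin T g (f' (restrict h (Field \<tau>))) sequentially"
    by (simp only:)
  then show ?thesis ..
qed

section \<open>Closed embeddings into the permutation group\<close>

lemma openin_left_translation_preimage:
  assumes G: "topological_group G T" and U: "openin T U" and a: "a \<in> carrier G"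
  shows "openin T {x \<in> carrier G. a \<otimes>\<^bsub>G\<^esub> x \<in> U}"
proof -
  have top: "topspace T = carrier G"
    and mult: "continuous_map (prod_topology T T) T (\<lambda>(x, y). x \<otimes>\<^bsub>G\<^esub> y)"
    using G by (auto simp: topological_group_def)
  have "continuous_map T (prod_topology T T) (\<lambda>x. (a, x))"
    using a top by (simp add: continuous_map_pairedI)
  from continuous_map_compose [OF this mult] have "continuous_map T T (\<lambda>x. a \<otimes>\<^bsub>G\<^esub> x)"
    by (simp add: o_def)
  from openin_continuous_map_preimage [OF this U] show ?thesis
    by (simp add: top)
qed

text \<open>
  For injective \<open>\<phi>\<close> this is continuity of the inverse of \<open>\<phi>\<close> at the identity: the
  pointwise stabilisers of initial segments form a neighbourhood base of the identity of
  \<^const>\<open>S_inf\<close>.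
\<close>

definition one_neighbourhoods_from_stabilisers ::
  "('a, 'm) monoid_scheme \<Rightarrow> 'a topology \<Rightarrow> ('a \<Rightarrow> nat \<Rightarrow> nat) \<Rightarrow> bool" where
  "one_neighbourhoods_from_stabilisers G T \<phi> \<longleftrightarrow>
     (\<forall>U. openin T U \<and> \<one>\<^bsub>G\<^esub> \<in> U \<longrightarrow>
        (\<exists>n. \<forall>x \<in> carrier G. (\<forall>k<n. \<phi> x k = k) \<longrightarrow> x \<in> U))"

text \<open>
  Translation carries the hypothesis from the identity to every point \<open>a\<close>: whatever
  \<open>\<phi>\<close> sends near \<open>\<phi> a\<close> is near \<open>a\<close>. In a Hausdorff group this
  yields injectivity as well as openness onto the image.
\<close>

lemma embedding_map_S_inf:
  assumes G: "topological_group G T" and T: "Hausdorff_space T"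
    and \<phi>: "\<phi> \<in> hom G S_inf" "continuous_map T S_inf_top \<phi>"
    and stab: "one_neighbourhoods_from_stabilisers G T \<phi>"
  shows "embedding_map T S_inf_top \<phi>"
proof -
  have grp: "group G" and top: "topspace T = carrier G"
    using G by (auto simp: topological_group_def)
  interpret group G by (rule grp)
  note hom = hom_S_inf_bij [OF grp \<phi>(1)] hom_S_inf_mult [OF grp \<phi>(1)]
    hom_S_inf_inv [OF grp \<phi>(1)] hom_S_inf_one [OF grp \<phi>(1)]
  have local_inverse: "\<exists>n. \<forall>x \<in> carrier G. (\<forall>k<n. \<phi> x k = \<phi> a k) \<longrightarrow> x \<in> U"
    if U: "openin T U" "a \<in> U" for U a
  proof -
    have a: "a \<in> carrier G"
      using U openin_subset top by blast
    have "openin T {x \<in> carrier G. a \<otimes>\<^bsub>G\<^esub> x \<in> U}"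
      using openin_left_translation_preimage [OF G U(1) a] .
    then obtain n where n: "\<And>x. x \<in> carrier G \<Longrightarrow> (\<forall>k<n. \<phi> x k = k) \<Longrightarrow> a \<otimes>\<^bsub>G\<^esub> x \<in> U"
      using stab U a unfolding one_neighbourhoods_from_stabilisers_def
      by (metis (no_types, lifting) mem_Collect_eq one_closed r_one)
    have "x \<in> U" if x: "x \<in> carrier G" "\<forall>k<n. \<phi> x k = \<phi> a k" for x
    proof -
      have "\<phi> (inv\<^bsub>G\<^esub> a \<otimes>\<^bsub>G\<^esub> x) k = k" if "k < n" for k
        using x a that by (simp add: hom bij_is_inj)
      then have "a \<otimes>\<^bsub>G\<^esub> (inv\<^bsub>G\<^esub> a \<otimes>\<^bsub>G\<^esub> x) \<in> U"
        using x a by (intro n) auto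
      then show ?thesis
        using x a by (simp add: m_assoc [symmetric])
    qed
    then show ?thesis by blast
  qed
  have inj: "inj_on \<phi> (topspace T)"
  proof (rule inj_onI, rule ccontr)
    fix x y assume xy: "x \<in> topspace T" "y \<in> topspace T" "\<phi> x = \<phi> y" "x \<noteq> y"
    then obtain U where "openin T U" "x \<in> U" "y \<notin> U"
      using T by (metis Hausdorff_space_def disjnt_iff)
    then show False
      using local_inverse [of U x] xy top by auto
  qed
  have open_map: "open_map T (subtopology S_inf_top (\<phi> ` topspace T)) \<phi>"
    unfolding open_map_def
  proof (intro allI impI)
    fix U assume U: "openin T U"
    have "\<exists>V. openin S_inf_top V \<and> \<phi> a \<in> V \<and> V \<inter> \<phi> ` topspace T \<subseteq> \<phi> ` U" if a: "a \<in> U" for a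
    proof -
      obtain n where n: "\<And>x. x \<in> carrier G \<Longrightarrow> \<forall>k<n. \<phi> x k = \<phi> a k \<Longrightarrow> x \<in> U"
        using local_inverse [OF U a] by blast
      define V where "V = topspace S_inf_top \<inter> (\<Inter>k<n. {f. bij f \<and> f k = \<phi> a k})"
      have "openin S_inf_top V"
        unfolding V_def
        by (cases "n = 0") (auto simp del: topspace_S_inf_top intro!: openin_Int openin_INT2 openin_S_inf_top_value)
      moreover have "\<phi> a \<in> V"
        using a U openin_subset top by (fastforce simp: V_def hom)
      moreover have "V \<inter> \<phi> ` topspace T \<subseteq> \<phi> ` U"
        using n top by (auto simp: V_def)
      ultimately show ?thesis by blast
    qed
    then have "\<phi> ` U = \<Union>{V. openin S_inf_top V \<and> V \<inter> \<phi> ` topspace T \<subseteq> \<phi> ` U} \<inter> \<phi> ` topspace T"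
      using openin_subset [OF U] by blast
    moreover have "openin S_inf_top (\<Union>{V. openin S_inf_top V \<and> V \<inter> \<phi> ` topspace T \<subseteq> \<phi> ` U})"
      by (rule openin_Union) auto
    ultimately show "openin (subtopology S_inf_top (\<phi> ` topspace T)) (\<phi> ` U)"
      unfolding openin_subtopology by blast
  qed
  have cont: "continuous_map T (subtopology S_inf_top (\<phi> ` topspace T)) \<phi>"
    using \<phi>(2) by (simp add: continuous_map_in_subtopology)
  have surj: "\<phi> ` topspace T = topspace (subtopology S_inf_top (\<phi> ` topspace T))"
    using continuous_map_image_subset_topspace [OF \<phi>(2)] by auto
  show ?thesis
    unfolding embedding_map_def
    by (rule bijective_open_imp_homeomorphic_map [OF cont open_map surj inj])
qed

text \<open>
  A point \<open>y\<close> of the closure is approximated by \<open>\<phi> (g n)\<close> to the point that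
  both \<open>\<phi> (g n)\<close> and its inverse agree with \<open>y\<close> and its inverse below \<open>n\<close>.
  Then \<open>\<phi>\<close> sends \<open>(g n)\<inverse> (g m)\<close> and \<open>g n (g m)\<inverse>\<close> into
  small stabilisers, so \<open>g\<close> is two-sided Cauchy, and the image of its limit is \<open>y\<close>.
\<close>

lemma closedin_image_S_inf:
  assumes G: "topological_group G T"
    and \<phi>: "\<phi> \<in> hom G S_inf" "continuous_map T S_inf_top \<phi>"
    and stab: "one_neighbourhoods_from_stabilisers G T \<phi>"
    and complete: "\<And>g. two_sided_Cauchy G T g \<Longrightarrow> \<exists>l. limitin T g l sequentially"
  shows "closedin S_inf_top (\<phi> ` carrier G)"
proof -
  have grp: "group G" and top: "topspace T = carrier G"
    using G by (auto simp: topological_group_def)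
  interpret group G by (rule grp)
  note hom = hom_S_inf_bij [OF grp \<phi>(1)] hom_S_inf_mult [OF grp \<phi>(1)]
    hom_S_inf_inv [OF grp \<phi>(1)] hom_S_inf_one [OF grp \<phi>(1)]
  have "y \<in> \<phi> ` carrier G" if y: "y \<in> S_inf_top closure_of (\<phi> ` carrier G)" for y
  proof -
    have bij_y: "bij y"
      using y by (simp add: in_closure_of)
    have "\<exists>a \<in> carrier G. (\<forall>k<n. \<phi> a k = y k) \<and> (\<forall>k<n. \<phi> a (inv_into UNIV y k) = k)" for n
    proof -
      \<comment> \<open>agreement with \<open>y\<close> on the preimages of \<open>{..<n}\<close> fixes the inverse below \<open>n\<close>\<close>
      define V where "V = topspace S_inf_top \<inter>
        (\<Inter>k\<in>{..<n} \<union> inv_into UNIV y ` {..<n}. {f. bij f \<and> f k = y k})"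
      have "openin S_inf_top V"
        unfolding V_def
        by (cases "n = 0") (auto simp del: topspace_S_inf_top intro!: openin_Int openin_INT2 openin_S_inf_top_value)
      moreover have "y \<in> V"
        by (auto simp: V_def bij_y)
      ultimately obtain a where a: "a \<in> carrier G" "\<phi> a \<in> V"
        using y unfolding in_closure_of by blast
      then show ?thesis
        using bij_y by (intro bexI [of _ a]) (auto simp: V_def bij_is_surj surj_f_inv_f)
    qed
    then obtain g where gG: "\<And>n. g n \<in> carrier G"
      and g: "\<And>n k. k < n \<Longrightarrow> \<phi> (g n) k = y k" "\<And>n k. k < n \<Longrightarrow> \<phi> (g n) (inv_into UNIV y k) = k"
      by metis
    have inv_g: "inv_into UNIV (\<phi> (g n)) k = inv_into UNIV y k" if "k < n" for k n
      using g(2) [OF that] hom(1) [OF gG] by (metis bij_inv_eq_iff)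
    have "two_sided_Cauchy G T g"
      unfolding two_sided_Cauchy_def
    proof (intro conjI allI impI)
      fix U assume U: "openin T U \<and> \<one>\<^bsub>G\<^esub> \<in> U"
      then obtain N where N: "\<And>x. x \<in> carrier G \<Longrightarrow> \<forall>k<N. \<phi> x k = k \<Longrightarrow> x \<in> U"
        using stab unfolding one_neighbourhoods_from_stabilisers_def by meson
      have "inv\<^bsub>G\<^esub> g n \<otimes>\<^bsub>G\<^esub> g m \<in> U \<and> g n \<otimes>\<^bsub>G\<^esub> inv\<^bsub>G\<^esub> g m \<in> U" if mn: "m \<ge> N" "n \<ge> N" for m n
      proof -
        have "\<phi> (inv\<^bsub>G\<^esub> g n \<otimes>\<^bsub>G\<^esub> g m) k = k" if "k < N" for k
        proof -
          have "\<phi> (g m) k = \<phi> (g n) k"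
            using that mn g(1) by simp
          then show ?thesis
            using gG by (simp add: hom bij_is_inj)
        qed
        moreover have "\<phi> (g n \<otimes>\<^bsub>G\<^esub> inv\<^bsub>G\<^esub> g m) k = k" if "k < N" for k
          using that mn gG g(2) inv_g by (simp add: hom)
        ultimately show ?thesis
          using gG by (auto intro!: N)
      qed
      then show "\<exists>N. \<forall>m\<ge>N. \<forall>n\<ge>N. inv\<^bsub>G\<^esub> g n \<otimes>\<^bsub>G\<^esub> g m \<in> U \<and> g n \<otimes>\<^bsub>G\<^esub> inv\<^bsub>G\<^esub> g m \<in> U"
        by blast
    qed (use gG in auto)
    then obtain l where l: "limitin T g l sequentially"
      using complete by blast
    then have "limitin S_inf_top (\<phi> \<circ> g) (\<phi> l) sequentially"
      by (rule continuous_map_limit [OF \<phi>(2)])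
    moreover have "limitin S_inf_top (\<phi> \<circ> g) y sequentially"
      unfolding limitin_S_inf_top eventually_sequentially
    proof (intro conjI allI)
      show "\<exists>N. \<forall>n\<ge>N. (\<phi> \<circ> g) n k = y k" for k
        using g(1) by (intro exI [of _ "Suc k"]) (simp add: Suc_le_eq)
      show "\<exists>N. \<forall>n\<ge>N. bij ((\<phi> \<circ> g) n)"
        using hom(1) [OF gG] by simp
    qed (rule bij_y)
    ultimately have "\<phi> l = y"
      using Hausdorff_space_S_inf_top limitin_Hausdorff_unique trivial_limit_sequentially by metis
    then show ?thesis
      using limitin_topspace [OF l] top by auto
  qed
  moreover have "\<phi> ` carrier G \<subseteq> topspace S_inf_top"
    using hom(1) by auto
  ultimately show ?thesis
    by (metis closure_of_subset_eq subsetI)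
qed

section \<open>Reduction to countably many coordinates\<close>

text \<open>
  Each member of a countable neighbourhood base at \<open>\<one>\<close> contains the preimage of a basic
  neighbourhood of the power, hence is controlled by finitely many coordinates; the sequence
  \<open>j\<close> enumerates, with repetitions if there are only finitely many, the coordinates that
  occur for some member of the base.
\<close>

lemma countably_many_coordinates:
  assumes G: "topological_group G T" and T: "first_countable T"
    and f: "f \<in> hom G (S_inf_power \<tau>)" "embedding_map T (S_inf_power_top \<tau>) f"
    and \<tau>: "Field \<tau> \<noteq> {}"
  obtains j :: "nat \<Rightarrow> 'i" where "range j \<subseteq> Field (\<tau> :: 'i rel)"
    and "\<And>U. openin T U \<Longrightarrow> \<one>\<^bsub>G\<^esub> \<in> U \<Longrightarrow>
           \<exists>n. \<forall>x \<in> carrier G. (\<forall>a<n. \<forall>k<n. f x (j a) k = k) \<longrightarrow> x \<in> U"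
proof -
  have grp: "group G" and top: "topspace T = carrier G"
    using G by (auto simp: topological_group_def)
  interpret group_hom G "S_inf_power \<tau>" f
    using grp f by (simp add: group_hom_def group_hom_axioms_def group_S_inf_power)
  obtain B where B: "countable B" "\<And>V. V \<in> B \<Longrightarrow> openin T V"
    "\<And>U. openin T U \<Longrightarrow> \<one>\<^bsub>G\<^esub> \<in> U \<Longrightarrow> \<exists>V\<in>B. \<one>\<^bsub>G\<^esub> \<in> V \<and> V \<subseteq> U"
    using T G.one_closed unfolding first_countable_def top by metis
  define controls where "controls F n V \<longleftrightarrow> finite F \<and> F \<subseteq> Field \<tau> \<and>
      (\<forall>x \<in> carrier G. (\<forall>i\<in>F. \<forall>k<n. f x i k = k) \<longrightarrow> x \<in> V)" for F and n :: nat and V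
  have "\<exists>F n. controls F n V"
    if V: "openin T V" "\<one>\<^bsub>G\<^esub> \<in> V" for V
  proof -
    have homeo: "homeomorphic_map T (subtopology (S_inf_power_top \<tau>) (f ` carrier G)) f"
      using f top by (simp add: embedding_map_def)
    have "openin (subtopology (S_inf_power_top \<tau>) (f ` carrier G)) (f ` V)"
      using homeomorphic_imp_open_map [OF homeo] V by (simp add: open_map_def)
    then obtain W where W: "openin (S_inf_power_top \<tau>) W" "f ` V = W \<inter> f ` carrier G"
      by (auto simp: openin_subtopology)
    have "\<one>\<^bsub>S_inf_power \<tau>\<^esub> \<in> W"
      using V W(2) hom_one by (metis IntD1 image_eqI)
    then obtain F n where F: "finite F" "F \<subseteq> Field \<tau>"
      and n: "\<And>h. h \<in> carrier (S_inf_power \<tau>) \<Longrightarrow> (\<forall>i\<in>F. \<forall>k<n. h i k = k) \<Longrightarrow> h \<in> W"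
      using S_inf_power_top_neighbourhood_one [OF W(1)] by blast
    have "x \<in> V" if "x \<in> carrier G" "\<forall>i\<in>F. \<forall>k<n. f x i k = k" for x
    proof -
      have "f x \<in> W"
        using n [OF hom_closed] that by blast
      then have "f x \<in> f ` V"
        using W(2) that(1) by blast
      moreover have "V \<subseteq> carrier G"
        using openin_subset [OF V(1)] top by simp
      moreover have "inj_on f (carrier G)"
        using homeomorphic_imp_injective_map [OF homeo] top by simp
      ultimately show ?thesis
        using that(1) inj_on_image_mem_iff by metis
    qed
    with F show ?thesis unfolding controls_def by blast
  qed
  then obtain F n where controls: "\<And>V. openin T V \<Longrightarrow> \<one>\<^bsub>G\<^esub> \<in> V \<Longrightarrow> controls (F V) (n V) V"
    by metis
  have F: "finite (F V)" "F V \<subseteq> Field \<tau>" if "V \<in> B" "\<one>\<^bsub>G\<^esub> \<in> V" for V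
    using controls [OF B(2) that(2)] that(1) by (auto simp: controls_def)
  obtain i0 where i0: "i0 \<in> Field \<tau>"
    using \<tau> by blast
  \<comment> \<open>\<open>i0\<close> keeps the set nonempty, so that it can be enumerated\<close>
  define J where "J = insert i0 (\<Union>V\<in>{V \<in> B. \<one>\<^bsub>G\<^esub> \<in> V}. F V)"
  have "countable {V \<in> B. \<one>\<^bsub>G\<^esub> \<in> V}"
    using B(1) by (rule countable_subset [rotated]) blast
  then have "countable (\<Union>V\<in>{V \<in> B. \<one>\<^bsub>G\<^esub> \<in> V}. F V)"
    by (rule countable_UN) (simp add: F(1) countable_finite)
  then have J: "countable J" "J \<noteq> {}" "J \<subseteq> Field \<tau>"
    using F(2) i0 by (auto simp: J_def)
  define j where "j = from_nat_into J"
  have ran: "range j = J"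
    using J by (simp add: j_def)
  show thesis
  proof
    show "range j \<subseteq> Field \<tau>"
      using ran J by simp
  next
    fix U assume U: "openin T U" "\<one>\<^bsub>G\<^esub> \<in> U"
    then obtain V where V: "V \<in> B" "\<one>\<^bsub>G\<^esub> \<in> V" "V \<subseteq> U"
      using B by blast
    have "F V \<subseteq> j ` UNIV"
      using V unfolding ran J_def by blast
    with F(1) [OF V(1,2)] obtain A where A: "finite A" "F V = j ` A"
      by (metis finite_subset_image)
    obtain N where N: "\<And>a. a \<in> A \<Longrightarrow> a < N"
      using A by (auto simp: finite_nat_set_iff_bounded)
    have "x \<in> U" if "x \<in> carrier G" "\<forall>a<max N (n V). \<forall>k<max N (n V). f x (j a) k = k" for x
    proof -
      have "\<forall>i\<in>F V. \<forall>k<n V. f x i k = k"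
        using that(2) N by (simp add: A(2) less_max_iff_disj)
      then show ?thesis
        using controls [OF B(2) V(2)] V that(1) by (auto simp: controls_def)
    qed
    then show "\<exists>n. \<forall>x \<in> carrier G. (\<forall>a<n. \<forall>k<n. f x (j a) k = k) \<longrightarrow> x \<in> U"
      by blast
  qed
qed

text \<open>
  The permutations \<open>h a\<close>, acting on the rows \<open>{a} \<times> UNIV\<close>, are transported to the
  natural numbers by the pairing function.
\<close>

definition interleave :: "(nat \<Rightarrow> nat \<Rightarrow> nat) \<Rightarrow> nat \<Rightarrow> nat" where
  "interleave h = prod_encode \<circ> (\<lambda>(a, k). (a, h a k)) \<circ> prod_decode"

lemma interleave_prod_encode [simp]: "interleave h (prod_encode (a, k)) = prod_encode (a, h a k)"
  by (simp add: interleave_def)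

lemma interleave_compose: "interleave (\<lambda>a. h a \<circ> h' a) = interleave h \<circ> interleave h'"
  by (auto simp: interleave_def fun_eq_iff split: prod.split)

lemma bij_interleave:
  assumes "\<And>a. bij (h a)"
  shows "bij (interleave h)"
proof -
  have id: "interleave (\<lambda>_. id) = id"
    by (simp add: interleave_def fun_eq_iff)
  have "inv_into UNIV (h a) \<circ> h a = id" for a
    using assms by (simp add: bij_is_inj)
  then have "interleave (\<lambda>a. inv_into UNIV (h a)) \<circ> interleave h = id"
    by (simp only: interleave_compose [symmetric] id)
  moreover have "h a \<circ> inv_into UNIV (h a) = id" for a
    using bij_is_surj [OF assms] by (simp add: surj_iff)
  then have "interleave h \<circ> interleave (\<lambda>a. inv_into UNIV (h a)) = id"
    by (simp only: interleave_compose [symmetric] id)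
  ultimately show ?thesis
    by (rule o_bij)
qed

text \<open>
  Each value of the interleaved permutation depends on a single value of a single coordinate. This
  gives continuity, and also that every stabiliser condition on finitely many coordinates follows
  from one on an initial segment.
\<close>

lemma closed_subgroup_power_imp_closed_subgroup:
  fixes \<tau> :: "'i rel"
  assumes G: "topological_group G T" and T: "metrizable_space T" and \<tau>: "Field \<tau> \<noteq> {}"
    and iso: "isomorphic_to_closed_subgroup G T (S_inf_power \<tau>) (S_inf_power_top \<tau>)"
  shows "isomorphic_to_closed_subgroup G T S_inf S_inf_top"
proof -
  have grp: "group G" and top: "topspace T = carrier G"
    using G by (auto simp: topological_group_def)
  obtain f where f: "f \<in> hom G (S_inf_power \<tau>)" "embedding_map T (S_inf_power_top \<tau>) f"
    "closedin (S_inf_power_top \<tau>) (f ` carrier G)"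
    using iso unfolding isomorphic_to_closed_subgroup_iff_embedding [OF grp group_S_inf_power top]
    by blast
  obtain j where j: "range j \<subseteq> Field \<tau>"
    and nbhd: "\<And>U. openin T U \<Longrightarrow> \<one>\<^bsub>G\<^esub> \<in> U \<Longrightarrow>
           \<exists>n. \<forall>x \<in> carrier G. (\<forall>a<n. \<forall>k<n. f x (j a) k = k) \<longrightarrow> x \<in> U"
    by (rule countably_many_coordinates [OF G metrizable_imp_first_countable [OF T] f(1,2) \<tau>])
      (erule that, blast)
  have hom_j: "(\<lambda>x. f x (j a)) \<in> hom G S_inf" for a
    using hom_S_inf_power_coordinate [OF f(1)] j by blast
  have cont_j: "continuous_map T S_inf_top (\<lambda>x. f x (j a))" for a
    using continuous_map_S_inf_power_coordinate [OF embedding_imp_continuous_map [OF f(2)]] j by blast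
  define \<phi> where "\<phi> x = interleave (\<lambda>a. f x (j a))" for x
  have bij_\<phi>: "bij (\<phi> x)" if "x \<in> carrier G" for x
    unfolding \<phi>_def using hom_S_inf_bij [OF grp hom_j that] by (rule bij_interleave)
  have \<phi>_hom: "\<phi> \<in> hom G S_inf"
  proof (rule homI)
    fix x y assume xy: "x \<in> carrier G" "y \<in> carrier G"
    have "\<phi> (x \<otimes>\<^bsub>G\<^esub> y) = \<phi> x \<circ> \<phi> y"
      using hom_S_inf_mult [OF grp hom_j xy] by (simp add: \<phi>_def interleave_compose [symmetric])
    then show "\<phi> (x \<otimes>\<^bsub>G\<^esub> y) = \<phi> x \<otimes>\<^bsub>S_inf\<^esub> \<phi> y"
      using xy bij_\<phi> by (simp add: mult_S_inf)
  qed (simp add: bij_\<phi>)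
  have \<phi>_cont: "continuous_map T S_inf_top \<phi>"
  proof -
    have "continuous_map T (discrete_topology UNIV) (\<lambda>x. \<phi> x k)" for k
    proof -
      obtain a m where "prod_decode k = (a, m)"
        by (cases "prod_decode k")
      then have k: "k = prod_encode (a, m)"
        using prod_decode_inverse [of k] by simp
      have "continuous_map S_inf_top (discrete_topology UNIV) (\<lambda>h. h m)"
        unfolding S_inf_top_def
        by (intro continuous_map_from_subtopology continuous_map_product_coordinates) simp
      from continuous_map_compose [OF cont_j this]
      have "continuous_map T (discrete_topology UNIV) (\<lambda>x. f x (j a) m)"
        by (simp add: o_def)
      from continuous_map_compose [OF this,
          of "discrete_topology UNIV" "\<lambda>p. prod_encode (a, p)"]
      have "continuous_map T (discrete_topology UNIV) (\<lambda>x. prod_encode (a, f x (j a) m))"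
        by (simp add: o_def)
      then show ?thesis
        by (simp add: k \<phi>_def)
    qed
    then have "continuous_map T (product_topology (\<lambda>_. discrete_topology UNIV) UNIV) \<phi>"
      unfolding continuous_map_componentwise by simp
    moreover have "\<phi> \<in> topspace T \<rightarrow> carrier S_inf"
      using bij_\<phi> unfolding top by simp
    ultimately show ?thesis
      unfolding S_inf_top_def continuous_map_in_subtopology by blast
  qed
  have stab: "one_neighbourhoods_from_stabilisers G T \<phi>"
    unfolding one_neighbourhoods_from_stabilisers_def
  proof (intro allI impI)
    fix U assume "openin T U \<and> \<one>\<^bsub>G\<^esub> \<in> U"
    then have "\<exists>n. \<forall>x \<in> carrier G. (\<forall>a<n. \<forall>k<n. f x (j a) k = k) \<longrightarrow> x \<in> U"
      by (intro nbhd) simp_all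
    then obtain n where n: "\<And>x. x \<in> carrier G \<Longrightarrow> \<forall>a<n. \<forall>k<n. f x (j a) k = k \<Longrightarrow> x \<in> U"
      by blast
    have "finite (prod_encode ` ({..<n} \<times> {..<n}))"
      by simp
    then obtain N where N: "\<forall>p \<in> prod_encode ` ({..<n} \<times> {..<n}). p < N"
      unfolding finite_nat_set_iff_bounded ..
    have "x \<in> U" if x: "x \<in> carrier G" "\<forall>k<N. \<phi> x k = k" for x
    proof (intro n allI impI)
      fix a k assume "a < n" "k < n"
      then have "prod_encode (a, k) < N"
        using N by blast
      then have "\<phi> x (prod_encode (a, k)) = prod_encode (a, k)"
        using x(2) by blast
      then show "f x (j a) k = k"
        by (simp add: \<phi>_def)
    qed (rule x)
    then show "\<exists>N. \<forall>x \<in> carrier G. (\<forall>k<N. \<phi> x k = k) \<longrightarrow> x \<in> U"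
      by blast
  qed
  have "embedding_map T S_inf_top \<phi>"
    using embedding_map_S_inf [OF G metrizable_imp_Hausdorff_space [OF T] \<phi>_hom \<phi>_cont stab] .
  moreover have "closedin S_inf_top (\<phi> ` carrier G)"
    using closedin_image_S_inf [OF G \<phi>_hom \<phi>_cont stab]
      closed_in_S_inf_power_imp_complete [OF G f] by blast
  ultimately show ?thesis
    unfolding isomorphic_to_closed_subgroup_iff_embedding [OF grp group_S_inf top]
    using \<phi>_hom by blast
qed

section \<open>The equivalence\<close>

theorem corollary4p5:
  fixes \<tau> :: "'i rel"
    and G :: "('a, 'm) monoid_scheme"
    and T :: "'a topology"
  assumes "Card_order \<tau>"
    and "ctwo \<le>o \<tau>"
    and "polish_group G T"
  shows "isomorphic_to_closed_subgroup G T S_inf S_inf_top \<longleftrightarrow>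
         isomorphic_to_closed_subgroup G T (S_inf_power \<tau>) (S_inf_power_top \<tau>)"
proof -
  have G: "topological_group G T" and T: "metrizable_space T"
    using assms(3) by (auto simp: polish_group_def completely_metrizable_imp_metrizable_space)
  have "Field \<tau> \<noteq> {}"
  proof -
    obtain e where "embed ctwo \<tau> e"
      using assms(2) by (auto simp: ordLeq_def)
    then have "e ` Field ctwo \<subseteq> Field \<tau>"
      by (rule embed_Field)
    then show ?thesis
      by (simp add: ctwo_def Field_card_of image_subset_iff) blast
  qed
  then obtain i where i: "i \<in> Field \<tau>"
    by blast
  show ?thesis
  proof
    assume iso: "isomorphic_to_closed_subgroup G T S_inf S_inf_top"
    have "group G" "topspace T = carrier G" "topspace S_inf_top = carrier S_inf"
      using G by (simp_all add: topological_group_def)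
    then show "isomorphic_to_closed_subgroup G T (S_inf_power \<tau>) (S_inf_power_top \<tau>)"
      by (intro isomorphic_to_closed_subgroup_trans [OF _ group_S_inf group_S_inf_power _ _ iso
          S_inf_isomorphic_to_closed_subgroup_power [OF i]])
  next
    assume "isomorphic_to_closed_subgroup G T (S_inf_power \<tau>) (S_inf_power_top \<tau>)"
    then show "isomorphic_to_closed_subgroup G T S_inf S_inf_top"
      using closed_subgroup_power_imp_closed_subgroup [OF G T \<open>Field \<tau> \<noteq> {}\<close>] by blast
  qed
qed

end
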